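(* Let $f=[f^L,f^U]\colon\mathbb{R}^n\to\mathcal{K}_c$ be an interval-valued function with $f^L,f^U\colon\mathbb{R}^n\to\mathbb{R}$ convex, let $g_j\colon\mathbb{R}^n\to\mathbb{R}$, $j\in J:=\{1,\dots,m\}$, be convex, and let $X=\{x\in\mathbb{R}^n : g_j(x)\le 0,\ j\in J\}$. Let $\mathcal{E}=[\epsilon^L,\epsilon^U]$ with $0\le\epsilon^L\le\epsilon^U$, and let $x^*\in X$. Assume that $X$ satisfies the Slater constraint qualification. Then $x^*$ is a weakly $\mathcal{E}$-$LU$-solution of the problem of minimizing $f$ over $X$ if and only if there exist $\mu^L\ge0$, $\mu^U\ge0$ with $\mu^L+\mu^U=1$, $\varepsilon_0\ge0$, $\varepsilon_j\ge0$ and $\lambda_j\ge0$, $j\in J$, such that $$0\in\partial_{\varepsilon_0}(\mu^Lf^L+\mu^Uf^U)(x^* )+\sum_{j=1}^m\partial_{\varepsilon_j}(\lambda_jg_j)(x^* )$$ and $$\sum_{j=0}^m\varepsilon_j-\mu^L\epsilon^U-\mu^U\epsilon^L\le\sum_{j=1}^m\lambda_jg_j(x^* ).$$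
   Context: $\mathcal{K}_c$ is the set of all closed bounded intervals $[a^L,a^U]\subset\mathbb{R}$, $a^L\le a^U$. An interval-valued function is $f(x)=[f^L(x),f^U(x)]$ with $f^L(x)\le f^U(x)$ for all $x$. Interval subtraction: $[a^L,a^U]-[b^L,b^U]=[a^L-b^U,\,a^U-b^L]$. Order: $[a^L,a^U]\prec^s_{LU}[b^L,b^U]$ iff $a^L<b^L$ and $a^U<b^U$. A point $x^*\in X$ is a weakly $\mathcal{E}$-$LU$-solution if there is no $x\in X$ with $f(x)\prec^s_{LU}f(x^* )-\mathcal{E}$. Slater constraint qualification: there exists $\hat x\in\mathbb{R}^n$ with $g_j(\hat x)<0$ for all $j\in J$. For a convex $\varphi\colon\mathbb{R}^n\to\mathbb{R}$ and $\varepsilon\ge0$, the $\varepsilon$-subdifferential at $x^*$ is $\partial_\varepsilon\varphi(x^* )=\{v\in\mathbb{R}^n : \varphi(x)-\varphi(x^* )\ge\langle v,x-x^*\rangle-\varepsilon\ \ \forall x\in\mathbb{R}^n\}$. *)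

theory Defs
  imports "HOL-Analysis.Analysis" "HOL-Library.Interval" "HOL-Library.Set_Algebras"
begin

text \<open>
  The set of closed bounded intervals is the type \<^typ>\<open>real interval\<close>; its subtraction satisfies
  \<open>lower (A - B) = lower A - upper B\<close> and \<open>upper (A - B) = upper A - lower B\<close>.  The library's
  \<open><\<close> and \<open>\<le>\<close> on intervals express inclusion, so the LU-order needs its own constant.
\<close>

definition less_LU :: "real interval \<Rightarrow> real interval \<Rightarrow> bool"  (infix \<open>\<prec>\<^sub>L\<^sub>U\<close> 50)
  where "A \<prec>\<^sub>L\<^sub>U B \<longleftrightarrow> lower A < lower B \<and> upper A < upper B"

definition feasible_set :: "'j set \<Rightarrow> ('j \<Rightarrow> 'a \<Rightarrow> real) \<Rightarrow> 'a set"
  where "feasible_set J g = {x. \<forall>j\<in>J. g j x \<le> 0}"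

definition slater_cq :: "'j set \<Rightarrow> ('j \<Rightarrow> 'a \<Rightarrow> real) \<Rightarrow> bool"
  where "slater_cq J g \<longleftrightarrow> (\<exists>x. \<forall>j\<in>J. g j x < 0)"

definition weakly_LU_solution :: "real interval \<Rightarrow> ('a \<Rightarrow> real interval) \<Rightarrow> 'a set \<Rightarrow> 'a \<Rightarrow> bool"
  where "weakly_LU_solution \<E> f X xs \<longleftrightarrow> xs \<in> X \<and> \<not> (\<exists>x\<in>X. f x \<prec>\<^sub>L\<^sub>U f xs - \<E>)"

definition eps_subdifferential :: "real \<Rightarrow> ('a::real_inner \<Rightarrow> real) \<Rightarrow> 'a \<Rightarrow> 'a set"
  where "eps_subdifferential \<epsilon> \<phi> xs = {v. \<forall>x. \<phi> x - \<phi> xs \<ge> v \<bullet> (x - xs) - \<epsilon>}"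

end

theory Submission
  imports Defs
begin

text \<open>
  For sufficiency, adding the \<open>\<epsilon>\<close>-subgradient inequalities bounds the scalarised objective over the
  feasible set from below by its value at \<open>xs\<close> minus \<open>\<mu>L * upper \<E> + \<mu>U * lower \<E>\<close>, which a strictly
  LU-better point would violate.

  For necessity, let \<open>C\<close> be the set where all constraints are strictly negative, which is nonempty
  by Slater's condition. On \<open>C\<close> the two shifted objectives are never both negative, so separation
  in the plane gives the weights \<open>\<mu>L\<close>, \<open>\<mu>U\<close>. The multipliers are then found one constraint at a
  time by the same planar alternative: a Slater point of the remaining constraints keeps the weight
  of the objective positive, and the treated constraint is absorbed into the objective. The
  resulting global inequality says that \<open>0\<close> is an \<open>\<epsilon>\<close>-subgradient of the Lagrangian, and the sum rule,
  which rests on an affine function between a concave and a convex one, distributes it over the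
  summands.
\<close>

section \<open>Planar alternative and Lagrange multipliers\<close>

lemma convex_combination_strict_mono:
  fixes a b c d u v :: real
  assumes "a < c" "b < d" "0 \<le> u" "0 \<le> v" "u + v = 1"
  shows "u * a + v * b < u * c + v * d"
proof -
  have "u * (a - c) + v * (b - d) < 0"
    using assms by (intro convex_bound_lt) auto
  then show ?thesis
    by (simp add: right_diff_distrib)
qed

text \<open>The pairs strictly above some \<open>(h x, k x)\<close> form a convex set missing the
  origin. A separating normal is nonnegative because this set is closed upwards, and it can be
  scaled to total weight 1.\<close>

lemma convex_pair_alternative:
  fixes h k :: "'a::real_vector \<Rightarrow> real"
  assumes h: "convex_on C h" and k: "convex_on C k"
    and no: "\<And>x. x \<in> C \<Longrightarrow> \<not> (h x < 0 \<and> k x < 0)"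
  obtains a b where "a \<ge> 0" "b \<ge> 0" "a + b = 1" "\<And>x. x \<in> C \<Longrightarrow> 0 \<le> a * h x + b * k x"
proof (cases "C = {}")
  case True
  then show ?thesis
    using that[of 0 1] by simp
next
  case False
  define S where "S = {(s, t). \<exists>x\<in>C. h x < s \<and> k x < t}"
  have "convex S"
    unfolding convex_def
  proof (intro ballI allI impI)
    fix p q :: "real \<times> real" and u v :: real
    assume "p \<in> S" "q \<in> S" and uv: "0 \<le> u" "0 \<le> v" "u + v = 1"
    obtain p1 p2 q1 q2 where pq: "p = (p1, p2)" "q = (q1, q2)"
      by (metis surj_pair)
    obtain x y where x: "x \<in> C" "h x < p1" "k x < p2" and y: "y \<in> C" "h y < q1" "k y < q2"
      using \<open>p \<in> S\<close> \<open>q \<in> S\<close> pq by (auto simp: S_def)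
    have "u *\<^sub>R x + v *\<^sub>R y \<in> C"
      using h x y uv by (auto simp: convex_on_def convex_def)
    moreover have "h (u *\<^sub>R x + v *\<^sub>R y) \<le> u * h x + v * h y"
      "k (u *\<^sub>R x + v *\<^sub>R y) \<le> u * k x + v * k y"
      using h k x y uv by (auto simp: convex_on_def)
    ultimately show "u *\<^sub>R p + v *\<^sub>R q \<in> S"
      using convex_combination_strict_mono[OF x(2) y(2) uv] convex_combination_strict_mono[OF x(3) y(3) uv]
      unfolding S_def pq
      by (auto intro!: bexI[of _ "u *\<^sub>R x + v *\<^sub>R y"])
  qed
  moreover have "0 \<notin> S"
    using no by (auto simp: S_def zero_prod_def)
  ultimately obtain d where "d \<noteq> 0" "\<forall>p\<in>S. 0 \<le> d \<bullet> p"
    using separating_hyperplane_set_0 by blast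
  moreover obtain a b where "d = (a, b)"
    by fastforce
  ultimately have ab: "a \<noteq> 0 \<or> b \<noteq> 0"
    and S: "\<And>s t. (s, t) \<in> S \<Longrightarrow> 0 \<le> a * s + b * t"
    by (auto simp: zero_prod_def)
  have C: "0 \<le> a * s + b * t" if "x \<in> C" "h x < s" "k x < t" for x s t
    using that by (intro S) (auto simp: S_def)
  obtain x0 where x0: "x0 \<in> C"
    using False by blast
  \<comment> \<open>An affine function of \<open>r\<close> that is nonnegative for all
    \<open>r > 0\<close> has nonnegative slope: with \<open>c < 0\<close>, the chosen
    \<open>r\<close> gives \<open>c * r = - (\<bar>e\<bar> + 1)\<close>.\<close>
  have nonneg: "c \<ge> 0" if "\<And>r. r > 0 \<Longrightarrow> 0 \<le> c * r + e" for c e :: real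
  proof (rule ccontr)
    assume "\<not> c \<ge> 0"
    then have "0 \<le> c * ((\<bar>e\<bar> + 1) / - c) + e"
      by (intro that divide_pos_pos) auto
    also have "c * ((\<bar>e\<bar> + 1) / - c) = - (\<bar>e\<bar> + 1)"
      using \<open>\<not> c \<ge> 0\<close> by simp
    finally have "0 \<le> - (\<bar>e\<bar> + 1) + e" .
    then show False
      by linarith
  qed
  have "0 \<le> a * r + (a * h x0 + b * (k x0 + 1))" if "r > 0" for r
    using C[OF x0, of "h x0 + r" "k x0 + 1"] that by (simp add: distrib_left add_ac)
  then have a: "a \<ge> 0"
    by (rule nonneg)
  have "0 \<le> b * r + (a * (h x0 + 1) + b * k x0)" if "r > 0" for r
    using C[OF x0, of "h x0 + 1" "k x0 + r"] that by (simp add: distrib_left add_ac)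
  then have b: "b \<ge> 0"
    by (rule nonneg)
  have pos: "a + b > 0"
    using a b ab by auto
  \<comment> \<open>\<open>C\<close> covers only points strictly above \<open>(h x, k x)\<close>;
    raising both coordinates by \<open>r\<close> costs exactly \<open>e\<close>, which is
    arbitrary.\<close>
  have "0 \<le> a * h x + b * k x" if "x \<in> C" for x
  proof (rule field_le_epsilon)
    fix e :: real
    assume "e > 0"
    define r where "r = e / (a + b)"
    have r: "r > 0" "(a + b) * r = e"
      using \<open>e > 0\<close> pos by (auto simp: r_def)
    have "0 \<le> a * (h x + r) + b * (k x + r)"
      using that r by (intro C) auto
    then show "0 \<le> a * h x + b * k x + e"
      using r(2) by (simp add: algebra_simps)
  qed
  then have "0 \<le> a / (a + b) * h x + b / (a + b) * k x" if "x \<in> C" for x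
    using pos that by (simp add: divide_simps)
  moreover have "a / (a + b) + b / (a + b) = 1"
    using pos by (simp add: add_divide_distrib[symmetric])
  ultimately show ?thesis
    using that[of "a / (a + b)" "b / (a + b)"] a b by simp
qed

lemma convex_strict_sublevels:
  assumes "\<And>j. j \<in> J \<Longrightarrow> convex_on UNIV (g j)"
  shows "convex {x. \<forall>j\<in>J. g j x < (0::real)}"
  unfolding convex_def
proof (intro ballI allI impI CollectI)
  fix x y j and u v :: real
  assume xy: "x \<in> {x. \<forall>j\<in>J. g j x < 0}" "y \<in> {x. \<forall>j\<in>J. g j x < 0}"
    and uv: "0 \<le> u" "0 \<le> v" "u + v = 1" and j: "j \<in> J"
  have "g j (u *\<^sub>R x + v *\<^sub>R y) \<le> u * g j x + v * g j y"
    using assms[OF j] uv by (auto simp: convex_on_def)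
  also have "\<dots> < 0"
    using convex_bound_lt[of "g j x" 0 "g j y" u v] xy j uv by auto
  finally show "g j (u *\<^sub>R x + v *\<^sub>R y) < 0" .
qed

text \<open>Induction on \<open>J\<close> with \<open>F\<close> arbitrary, since each step replaces
  \<open>F\<close> by \<open>F + c * g i\<close>, nonnegative where the remaining constraints are
  strictly negative.\<close>

lemma lagrange_multipliers_slater:
  fixes F :: "'a::real_vector \<Rightarrow> real"
  assumes "finite J" "convex_on UNIV F" "\<And>j. j \<in> J \<Longrightarrow> convex_on UNIV (g j)"
    and "slater_cq J g"
    and "\<And>x. \<forall>j\<in>J. g j x < 0 \<Longrightarrow> 0 \<le> F x"
  obtains l where "\<And>j. j \<in> J \<Longrightarrow> l j \<ge> 0" "\<And>x. 0 \<le> F x + (\<Sum>j\<in>J. l j * g j x)"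
proof -
  have "\<exists>l. (\<forall>j\<in>J. l j \<ge> 0) \<and> (\<forall>x. 0 \<le> F x + (\<Sum>j\<in>J. l j * g j x))"
    using assms
  proof (induction arbitrary: F rule: finite_induct)
    case empty
    then show ?case by simp
  next
    case (insert i J)
    let ?C = "{x. \<forall>j\<in>J. g j x < 0}"
    obtain x0 where x0: "\<forall>j\<in>insert i J. g j x0 < 0"
      using insert.prems by (auto simp: slater_cq_def)
    have cC: "convex ?C"
      using insert.prems by (intro convex_strict_sublevels) auto
    have "\<not> (F x < 0 \<and> g i x < 0)" if "x \<in> ?C" for x
      using insert.prems(4)[of x] that by auto
    then obtain a b where ab: "a \<ge> 0" "b \<ge> 0" "a + b = 1"
      and C: "\<And>x. x \<in> ?C \<Longrightarrow> 0 \<le> a * F x + b * g i x"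
      using convex_pair_alternative[of ?C F "g i"] insert.prems cC
      by (metis (no_types, lifting) convex_on_subset insertI1 subset_UNIV)
    \<comment> \<open>If \<open>a = 0\<close> then \<open>b = 1\<close>, so \<open>g i\<close> would
      be nonnegative at the Slater point \<open>x0\<close>.\<close>
    have "a \<noteq> 0"
      using C[of x0] x0 ab by auto
    then have a: "a > 0"
      using ab by simp
    define c where "c = b / a"
    have c: "0 \<le> F x + c * g i x" if "x \<in> ?C" for x
      using C[OF that] a ab by (auto simp: c_def field_simps)
    have c0: "c \<ge> 0"
      using a ab by (simp add: c_def)
    have "\<exists>l. (\<forall>j\<in>J. l j \<ge> 0) \<and> (\<forall>x. 0 \<le> (F x + c * g i x) + (\<Sum>j\<in>J. l j * g j x))"
    proof (rule insert.IH)
      show "convex_on UNIV (\<lambda>x. F x + c * g i x)"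
        using insert.prems c0 by (intro convex_on_add convex_on_cmul) auto
      show "slater_cq J g"
        using x0 by (auto simp: slater_cq_def)
    qed (use insert.prems c in auto)
    then obtain l where l: "\<forall>j\<in>J. l j \<ge> 0"
      "\<And>x. 0 \<le> (F x + c * g i x) + (\<Sum>j\<in>J. l j * g j x)"
      by blast
    have "(\<Sum>j\<in>J. (l(i := c)) j * g j x) = (\<Sum>j\<in>J. l j * g j x)" for x
      using insert.hyps by (intro sum.cong) auto
    then show ?case
      using l c0 insert.hyps by (intro exI[of _ "l(i := c)"]) (simp add: add.assoc)
  qed
  then show ?thesis
    using that by blast
qed

section \<open>Sum rule for \<open>\<epsilon>\<close>-subdifferentials\<close>

text \<open>A hyperplane separating the epigraph of \<open>\<phi>\<close> from the hypograph of
  \<open>- \<psi>\<close> cannot be vertical, as both functions are finite everywhere; hence it is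
  the graph of an affine function.\<close>

lemma affine_sandwich:
  fixes \<phi> \<psi> :: "'a::euclidean_space \<Rightarrow> real"
  assumes \<phi>: "convex_on UNIV \<phi>" and \<psi>: "convex_on UNIV \<psi>" and ge: "\<And>x. - \<psi> x \<le> \<phi> x"
  obtains v c where "\<And>x. - \<psi> x \<le> v \<bullet> x + c" "\<And>x. v \<bullet> x + c \<le> \<phi> x"
proof -
  \<comment> \<open>The epigraph is strict so that \<open>A\<close> and \<open>B\<close> stay
    disjoint even where \<open>\<phi>\<close> and \<open>- \<psi>\<close> touch.\<close>
  define A where "A = {(x, t). \<phi> x < t}"
  define B where "B = {(x, t). \<psi> x \<le> - t}"
  have "convex A"
    unfolding convex_def
  proof (intro ballI allI impI)
    fix p q :: "'a \<times> real" and u v :: real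
    assume "p \<in> A" "q \<in> A" and uv: "0 \<le> u" "0 \<le> v" "u + v = 1"
    then have pq: "\<phi> (fst p) < snd p" "\<phi> (fst q) < snd q"
      by (auto simp: A_def)
    have "\<phi> (u *\<^sub>R fst p + v *\<^sub>R fst q) \<le> u * \<phi> (fst p) + v * \<phi> (fst q)"
      using \<phi> uv by (auto simp: convex_on_def)
    also have "\<dots> < u * snd p + v * snd q"
      using pq uv by (rule convex_combination_strict_mono)
    finally show "u *\<^sub>R p + v *\<^sub>R q \<in> A"
      by (simp add: A_def case_prod_unfold)
  qed
  moreover have "convex B"
    unfolding convex_def
  proof (intro ballI allI impI)
    fix p q :: "'a \<times> real" and u v :: real
    assume "p \<in> B" "q \<in> B" and uv: "0 \<le> u" "0 \<le> v" "u + v = 1"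
    then have pq: "\<psi> (fst p) \<le> - snd p" "\<psi> (fst q) \<le> - snd q"
      by (auto simp: B_def)
    have "\<psi> (u *\<^sub>R fst p + v *\<^sub>R fst q) \<le> u * \<psi> (fst p) + v * \<psi> (fst q)"
      using \<psi> uv by (auto simp: convex_on_def)
    also have "\<dots> \<le> u * (- snd p) + v * (- snd q)"
      using pq uv by (intro add_mono mult_left_mono) auto
    finally show "u *\<^sub>R p + v *\<^sub>R q \<in> B"
      by (simp add: B_def case_prod_unfold)
  qed
  moreover have "(0, \<phi> 0 + 1) \<in> A" "(0, - \<psi> 0) \<in> B"
    by (auto simp: A_def B_def)
  moreover have "A \<inter> B = {}"
  proof -
    have False if "\<phi> x < t" "\<psi> x \<le> - t" for x t
      using ge[of x] that by linarith
    then show ?thesis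
      by (auto simp: A_def B_def)
  qed
  ultimately obtain d b where d: "d \<noteq> 0" "\<forall>p\<in>A. d \<bullet> p \<le> b" "\<forall>p\<in>B. b \<le> d \<bullet> p"
    using separating_hyperplane_sets[of A B] by blast
  obtain u s where us: "d = (u, s)"
    by fastforce
  have A: "u \<bullet> x + s * t \<le> b" if "\<phi> x < t" for x t
    using d(2) that us by (auto simp: A_def)
  have B: "b \<le> u \<bullet> x + s * (- \<psi> x)" for x
    using bspec[OF d(3), of "(x, - \<psi> x)"] us by (simp add: B_def)
  \<comment> \<open>Over \<open>x = 0\<close>, the chosen point of \<open>A\<close> lies strictly
    above that of \<open>B\<close>, which fixes the sign of the vertical component.\<close>
  have "s \<le> 0"
  proof -
    have "s * (\<phi> 0 + 1) \<le> s * (- \<psi> 0)"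
      using A[of 0 "\<phi> 0 + 1"] B[of 0] by simp
    then show ?thesis
      using ge[of 0] by (smt (verit) mult_less_cancel_left_pos)
  qed
  moreover have "s \<noteq> 0"
  proof
    assume s: "s = 0"
    have "u \<bullet> x = b" for x
      using A[of x "\<phi> x + 1"] B[of x] s by simp
    from this[of u] this[of 0] have "u = 0"
      by simp
    then show False
      using d us s by (simp add: zero_prod_def)
  qed
  ultimately have s: "s < 0"
    by simp
  \<comment> \<open>Solving \<open>u \<bullet> x + s * t = b\<close> for \<open>t\<close> gives
    slope \<open>v\<close> and intercept \<open>b / s\<close>.\<close>
  define v where "v = (- 1 / s) *\<^sub>R u"
  have "- \<psi> x \<le> v \<bullet> x + b / s" for x
    using B[of x] s by (simp add: v_def field_simps)
  moreover have "v \<bullet> x + b / s \<le> \<phi> x" for x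
  proof (rule dense_ge)
    fix t
    assume "\<phi> x < t"
    then show "v \<bullet> x + b / s \<le> t"
      using A[of x t] s by (simp add: v_def field_simps)
  qed
  ultimately show ?thesis
    using that by blast
qed

text \<open>The subgradient inequality says that \<open>\<phi> x - \<phi> z\<close> lies above a
  concave function: the negative of \<open>\<psi>\<close> plus an affine term. The slope of an
  affine function in between serves as \<open>v\<close>.\<close>

lemma eps_subdifferential_add_split:
  fixes \<phi> \<psi> :: "'a::euclidean_space \<Rightarrow> real"
  assumes \<phi>: "convex_on UNIV \<phi>" and \<psi>: "convex_on UNIV \<psi>"
    and w: "w \<in> eps_subdifferential \<epsilon> (\<lambda>x. \<phi> x + \<psi> x) z"
  obtains v \<delta> \<eta> where "\<delta> \<ge> 0" "\<eta> \<ge> 0" "\<delta> + \<eta> = \<epsilon>"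
    "v \<in> eps_subdifferential \<delta> \<phi> z" "w - v \<in> eps_subdifferential \<eta> \<psi> z"
proof -
  have "convex_on UNIV (\<lambda>x. (- w) \<bullet> x)"
    by (simp add: convex_on_def inner_add_right)
  then have cvx: "convex_on UNIV (\<lambda>x. \<phi> x + - \<phi> z)"
    "convex_on UNIV (\<lambda>x. \<psi> x + ((- w) \<bullet> x + (w \<bullet> z + \<epsilon> - \<psi> z)))"
    using \<phi> \<psi> by (intro convex_on_add; simp add: convex_on_const)+
  have "- (\<psi> x + ((- w) \<bullet> x + (w \<bullet> z + \<epsilon> - \<psi> z))) \<le> \<phi> x + - \<phi> z" for x
    using w by (auto simp: eps_subdifferential_def inner_diff_right algebra_simps)
  then obtain v c where vc: "\<And>x. - (\<psi> x + ((- w) \<bullet> x + (w \<bullet> z + \<epsilon> - \<psi> z))) \<le> v \<bullet> x + c"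
    "\<And>x. v \<bullet> x + c \<le> \<phi> x + - \<phi> z"
    using affine_sandwich[OF cvx] by blast
  \<comment> \<open>\<open>\<delta>\<close> is the gap at \<open>z\<close> below the upper function,
    which vanishes there. The lower function equals \<open>- \<epsilon>\<close> at \<open>z\<close>,
    so the other gap is \<open>\<epsilon> - \<delta>\<close>.\<close>
  define \<delta> where "\<delta> = - (v \<bullet> z + c)"
  have "\<delta> \<ge> 0" "\<epsilon> - \<delta> \<ge> 0"
    using vc[of z] by (auto simp: \<delta>_def)
  moreover have "v \<in> eps_subdifferential \<delta> \<phi> z"
    using vc(2) by (auto simp: eps_subdifferential_def \<delta>_def inner_diff_right algebra_simps)
  moreover have "w - v \<in> eps_subdifferential (\<epsilon> - \<delta>) \<psi> z"
    unfolding eps_subdifferential_def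
  proof (intro CollectI allI)
    fix x
    show "(w - v) \<bullet> (x - z) - (\<epsilon> - \<delta>) \<le> \<psi> x - \<psi> z"
      using vc(1)[of x] by (simp add: \<delta>_def inner_diff_right inner_diff_left)
  qed
  ultimately show ?thesis
    using that[of \<delta> "\<epsilon> - \<delta>" v] by simp
qed

text \<open>
  Only \<open>\<le> \<epsilon>\<close> can be claimed for the sum of the parts: over the empty index set it is \<open>0\<close>.
\<close>

lemma eps_subdifferential_sum_split:
  fixes h :: "'i \<Rightarrow> 'a::euclidean_space \<Rightarrow> real"
  assumes "finite I" "\<And>i. i \<in> I \<Longrightarrow> convex_on UNIV (h i)" "\<epsilon> \<ge> 0"
    and "w \<in> eps_subdifferential \<epsilon> (\<lambda>x. \<Sum>i\<in>I. h i x) z"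
  obtains e where "\<And>i. i \<in> I \<Longrightarrow> e i \<ge> 0" "(\<Sum>i\<in>I. e i) \<le> \<epsilon>"
    "w \<in> (\<Sum>i\<in>I. eps_subdifferential (e i) (h i) z)"
proof -
  have "\<exists>e. (\<forall>i\<in>I. e i \<ge> 0) \<and> (\<Sum>i\<in>I. e i) \<le> \<epsilon> \<and>
      w \<in> (\<Sum>i\<in>I. eps_subdifferential (e i) (h i) z)"
    using assms
  proof (induction arbitrary: w \<epsilon> rule: finite_induct)
    case empty
    have "w = 0"
    proof (rule ccontr)
      assume "w \<noteq> 0"
      \<comment> \<open>Moving by \<open>r *\<^sub>R w\<close> makes the inner product
        \<open>\<epsilon> + 1\<close>, too large for an \<open>\<epsilon>\<close>-subgradient of the
        zero function.\<close>
      define r where "r = (\<epsilon> + 1) / (w \<bullet> w)"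
      have "w \<bullet> ((z + r *\<^sub>R w) - z) \<le> \<epsilon>"
        using empty.prems(3) unfolding eps_subdifferential_def
        by (auto dest!: spec[of _ "z + r *\<^sub>R w"])
      then show False
        using \<open>w \<noteq> 0\<close> by (simp add: r_def)
    qed
    then show ?case
      using empty.prems by (simp add: set_zero)
  next
    case (insert i I)
    have w: "w \<in> eps_subdifferential \<epsilon> (\<lambda>x. h i x + (\<Sum>i\<in>I. h i x)) z"
      using insert by simp
    have cvx: "convex_on UNIV (\<lambda>x. \<Sum>i\<in>I. h i x)"
      using insert.hyps(1) insert.prems(1)
      by (induction rule: finite_induct) (auto simp: convex_on_const intro!: convex_on_add)
    obtain v \<delta> \<eta> where v: "\<delta> \<ge> 0" "\<eta> \<ge> 0" "\<delta> + \<eta> = \<epsilon>"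
      "v \<in> eps_subdifferential \<delta> (h i) z" "w - v \<in> eps_subdifferential \<eta> (\<lambda>x. \<Sum>i\<in>I. h i x) z"
      using eps_subdifferential_add_split[OF insert.prems(1)[OF insertI1] cvx w] .
    obtain e where e: "\<forall>i\<in>I. e i \<ge> 0" "(\<Sum>i\<in>I. e i) \<le> \<eta>"
      "w - v \<in> (\<Sum>i\<in>I. eps_subdifferential (e i) (h i) z)"
      using insert.IH[OF _ v(2,5)] insert.prems(1) by auto
    let ?e = "e(i := \<delta>)"
    have eqs: "(\<Sum>j\<in>I. ?e j) = (\<Sum>j\<in>I. e j)"
      "(\<Sum>j\<in>I. eps_subdifferential (?e j) (h j) z) = (\<Sum>j\<in>I. eps_subdifferential (e j) (h j) z)"
      by (rule sum.cong[OF refl]; use insert.hyps in force)+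
    have "v + (w - v) \<in> eps_subdifferential \<delta> (h i) z + (\<Sum>j\<in>I. eps_subdifferential (e j) (h j) z)"
      using v e by (intro set_plus_intro)
    then show ?case
      using v e eqs insert.hyps by (intro exI[of _ ?e]) simp
  qed
  then show ?thesis
    using that by blast
qed

text \<open>The easy inclusion of the sum rule, used for sufficiency: the defining inequalities of
  the summands add up.\<close>

lemma eps_subdifferential_sumD:
  fixes h :: "'i \<Rightarrow> 'a::real_inner \<Rightarrow> real"
  assumes "finite I" "w \<in> (\<Sum>i\<in>I. eps_subdifferential (e i) (h i) z)"
  shows "w \<in> eps_subdifferential (\<Sum>i\<in>I. e i) (\<lambda>x. \<Sum>i\<in>I. h i x) z"
  using assms
proof (induction arbitrary: w rule: finite_induct)
  case empty
  then show ?case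
    by (simp add: eps_subdifferential_def set_zero)
next
  case (insert i I)
  then obtain a b where w: "w = a + b" and a: "a \<in> eps_subdifferential (e i) (h i) z"
    and "b \<in> (\<Sum>i\<in>I. eps_subdifferential (e i) (h i) z)"
    by (auto elim: set_plus_elim)
  then have "b \<in> eps_subdifferential (\<Sum>i\<in>I. e i) (\<lambda>x. \<Sum>i\<in>I. h i x) z"
    using insert.IH by blast
  then have "(a + b) \<bullet> (x - z) - (e i + (\<Sum>i\<in>I. e i))
      \<le> (h i x + (\<Sum>i\<in>I. h i x)) - (h i z + (\<Sum>i\<in>I. h i z))" for x
    using a add_mono[of "a \<bullet> (x - z) - e i" "h i x - h i z" "b \<bullet> (x - z) - (\<Sum>i\<in>I. e i)"]
    by (simp add: eps_subdifferential_def inner_add_left add_diff_add)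
  then show ?case
    using insert.hyps by (simp add: w eps_subdifferential_def)
qed

section \<open>Characterisation of weak \<open>\<E>\<close>-LU-solutions\<close>

theorem theorem4p2:
  fixes f :: "real ^ 'n \<Rightarrow> real interval"
    and g :: "nat \<Rightarrow> real ^ 'n \<Rightarrow> real"
    and m :: nat
    and \<E> :: "real interval"
    and xs :: "real ^ 'n"
  assumes "convex_on UNIV (\<lambda>x. lower (f x))"
    and "convex_on UNIV (\<lambda>x. upper (f x))"
    and "\<And>j. j \<in> {1..m} \<Longrightarrow> convex_on UNIV (g j)"
    and "0 \<le> lower \<E>"
    and "xs \<in> feasible_set {1..m} g"
    and "slater_cq {1..m} g"
  shows "weakly_LU_solution \<E> f (feasible_set {1..m} g) xs \<longleftrightarrow>
    (\<exists>(\<mu>L::real) (\<mu>U::real) (\<epsilon>::nat \<Rightarrow> real) (l::nat \<Rightarrow> real).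
       \<mu>L \<ge> 0 \<and> \<mu>U \<ge> 0 \<and> \<mu>L + \<mu>U = 1 \<and>
       (\<forall>j\<in>{0..m}. \<epsilon> j \<ge> 0) \<and> (\<forall>j\<in>{1..m}. l j \<ge> 0) \<and>
       0 \<in> eps_subdifferential (\<epsilon> 0) (\<lambda>x. \<mu>L * lower (f x) + \<mu>U * upper (f x)) xs
           + (\<Sum>j = 1..m. eps_subdifferential (\<epsilon> j) (\<lambda>x. l j * g j x) xs) \<and>
       (\<Sum>j = 0..m. \<epsilon> j) - \<mu>L * upper \<E> - \<mu>U * lower \<E> \<le> (\<Sum>j = 1..m. l j * g j xs))"
proof -
  define F where "F \<mu>L \<mu>U x = \<mu>L * lower (f x) + \<mu>U * upper (f x)" for \<mu>L \<mu>U x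
  \<comment> \<open>The objective becomes summand 0, so that one sum over \<open>{0..m}\<close>
    covers it and the weighted constraints.\<close>
  define h where "h \<mu>L \<mu>U l j = (if j = 0 then F \<mu>L \<mu>U else (\<lambda>x. l j * g j x))"
    for \<mu>L \<mu>U and l :: "nat \<Rightarrow> real" and j :: nat
  have split0: "(\<Sum>j = 0..m. k j) = k 0 + (\<Sum>j = 1..m. k j)" for k :: "nat \<Rightarrow> 'b::comm_monoid_add"
    by (simp add: sum.atLeast_Suc_atMost)
  have h_sum: "(\<Sum>j = 0..m. h \<mu>L \<mu>U l j x) = F \<mu>L \<mu>U x + (\<Sum>j = 1..m. l j * g j x)" for \<mu>L \<mu>U l x
    unfolding split0 by (simp add: h_def)
  have h_sub: "(\<Sum>j = 0..m. eps_subdifferential (\<epsilon> j) (h \<mu>L \<mu>U l j) xs) =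
      eps_subdifferential (\<epsilon> 0) (F \<mu>L \<mu>U) xs
      + (\<Sum>j = 1..m. eps_subdifferential (\<epsilon> j) (\<lambda>x. l j * g j x) xs)" for \<mu>L \<mu>U l \<epsilon>
    unfolding split0 by (simp add: h_def)
  have F_eta: "(\<lambda>x. \<mu>L * lower (f x) + \<mu>U * upper (f x)) = F \<mu>L \<mu>U" for \<mu>L \<mu>U
    by (simp add: F_def fun_eq_iff)
  show ?thesis
    unfolding F_eta
  proof
    assume weak: "weakly_LU_solution \<E> f (feasible_set {1..m} g) xs"
    let ?C = "{x. \<forall>j\<in>{1..m}. g j x < 0}"
    \<comment> \<open>Both shifted functions are negative at \<open>x\<close> exactly if
      \<open>f x\<close> is strictly LU-below \<open>f xs - \<E>\<close>; interval subtraction pairs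
      \<open>lower\<close> with \<open>upper \<E>\<close> and conversely.\<close>
    let ?L = "\<lambda>x. lower (f x) + (upper \<E> - lower (f xs))"
    let ?U = "\<lambda>x. upper (f x) + (lower \<E> - upper (f xs))"
    have cC: "convex ?C"
      using assms(3) by (intro convex_strict_sublevels)
    have "\<not> (?L x < 0 \<and> ?U x < 0)" if "x \<in> ?C" for x
    proof -
      have "x \<in> feasible_set {1..m} g"
        using that by (auto simp: feasible_set_def intro: less_imp_le)
      then have "\<not> f x \<prec>\<^sub>L\<^sub>U f xs - \<E>"
        using weak by (auto simp: weakly_LU_solution_def)
      then show ?thesis
        by (auto simp: less_LU_def)
    qed
    moreover have "convex_on ?C ?L" "convex_on ?C ?U"
      using assms(1,2) cC by (auto intro!: convex_on_add simp: convex_on_const intro: convex_on_subset)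
    ultimately obtain \<mu>L \<mu>U where \<mu>: "\<mu>L \<ge> 0" "\<mu>U \<ge> 0" "\<mu>L + \<mu>U = 1"
      and C: "\<And>x. x \<in> ?C \<Longrightarrow> 0 \<le> \<mu>L * ?L x + \<mu>U * ?U x"
      using convex_pair_alternative[of ?C ?L ?U] by blast
    \<comment> \<open>With this \<open>c\<close>, the combination of \<open>?L\<close> and
      \<open>?U\<close> equals \<open>F \<mu>L \<mu>U x + (c - F \<mu>L \<mu>U xs)\<close>.\<close>
    define c where "c = \<mu>L * upper \<E> + \<mu>U * lower \<E>"
    have cF: "convex_on UNIV (F \<mu>L \<mu>U)"
      unfolding F_def using assms(1,2) \<mu> by (intro convex_on_add convex_on_cmul)
    have "convex_on UNIV (\<lambda>x. F \<mu>L \<mu>U x + (c - F \<mu>L \<mu>U xs))"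
      using cF by (auto intro!: convex_on_add simp: convex_on_const)
    moreover have "0 \<le> F \<mu>L \<mu>U x + (c - F \<mu>L \<mu>U xs)" if "\<forall>j\<in>{1..m}. g j x < 0" for x
      using C[of x] that by (simp add: F_def c_def algebra_simps)
    ultimately obtain l where l: "\<And>j. j \<in> {1..m} \<Longrightarrow> l j \<ge> 0"
      "\<And>x. 0 \<le> F \<mu>L \<mu>U x + (c - F \<mu>L \<mu>U xs) + (\<Sum>j\<in>{1..m}. l j * g j x)"
      using lagrange_multipliers_slater[of "{1..m}" "\<lambda>x. F \<mu>L \<mu>U x + (c - F \<mu>L \<mu>U xs)" g] assms(3,6)
      by blast
    \<comment> \<open>\<open>l(2)\<close> bounds the Lagrangian below by its value at
      \<open>xs\<close> minus this \<open>\<eta>\<close>. A total of the \<open>\<epsilon> j\<close>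
      of at most \<open>\<eta>\<close> is then precisely the required final inequality.\<close>
    define \<eta> where "\<eta> = c + (\<Sum>j = 1..m. l j * g j xs)"
    have "\<eta> \<ge> 0"
      using l(2)[of xs] by (simp add: \<eta>_def)
    moreover have "0 \<in> eps_subdifferential \<eta> (\<lambda>x. \<Sum>j = 0..m. h \<mu>L \<mu>U l j x) xs"
      unfolding h_sum eps_subdifferential_def \<eta>_def using l(2) by (auto simp: algebra_simps)
    moreover have "convex_on UNIV (h \<mu>L \<mu>U l j)" if "j \<in> {0..m}" for j
      using that cF assms(3)[of j] l(1)[of j] by (auto simp: h_def intro!: convex_on_cmul)
    ultimately obtain \<epsilon> where \<epsilon>: "\<And>j. j \<in> {0..m} \<Longrightarrow> \<epsilon> j \<ge> 0" "(\<Sum>j = 0..m. \<epsilon> j) \<le> \<eta>"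
      "0 \<in> (\<Sum>j = 0..m. eps_subdifferential (\<epsilon> j) (h \<mu>L \<mu>U l j) xs)"
      using eps_subdifferential_sum_split[of "{0..m}" "h \<mu>L \<mu>U l" \<eta> 0 xs] by blast
    then show "\<exists>\<mu>L \<mu>U \<epsilon> l. \<mu>L \<ge> 0 \<and> \<mu>U \<ge> 0 \<and> \<mu>L + \<mu>U = 1 \<and>
       (\<forall>j\<in>{0..m}. \<epsilon> j \<ge> 0) \<and> (\<forall>j\<in>{1..m}. l j \<ge> 0) \<and>
       0 \<in> eps_subdifferential (\<epsilon> 0) (F \<mu>L \<mu>U) xs
           + (\<Sum>j = 1..m. eps_subdifferential (\<epsilon> j) (\<lambda>x. l j * g j x) xs) \<and>
       (\<Sum>j = 0..m. \<epsilon> j) - \<mu>L * upper \<E> - \<mu>U * lower \<E> \<le> (\<Sum>j = 1..m. l j * g j xs)"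
      using \<mu> l(1) \<epsilon> unfolding h_sub \<eta>_def c_def
      by (intro exI[of _ \<mu>L] exI[of _ \<mu>U] exI[of _ \<epsilon>] exI[of _ l]) auto
  next
    assume "\<exists>\<mu>L \<mu>U \<epsilon> l. \<mu>L \<ge> 0 \<and> \<mu>U \<ge> 0 \<and> \<mu>L + \<mu>U = 1 \<and>
       (\<forall>j\<in>{0..m}. \<epsilon> j \<ge> 0) \<and> (\<forall>j\<in>{1..m}. l j \<ge> 0) \<and>
       0 \<in> eps_subdifferential (\<epsilon> 0) (F \<mu>L \<mu>U) xs
           + (\<Sum>j = 1..m. eps_subdifferential (\<epsilon> j) (\<lambda>x. l j * g j x) xs) \<and>
       (\<Sum>j = 0..m. \<epsilon> j) - \<mu>L * upper \<E> - \<mu>U * lower \<E> \<le> (\<Sum>j = 1..m. l j * g j xs)"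
    then obtain \<mu>L \<mu>U \<epsilon> l where \<mu>: "\<mu>L \<ge> 0" "\<mu>U \<ge> 0" "\<mu>L + \<mu>U = 1"
      and l: "\<forall>j\<in>{1..m}. l j \<ge> 0"
      and sub: "0 \<in> (\<Sum>j = 0..m. eps_subdifferential (\<epsilon> j) (h \<mu>L \<mu>U l j) xs)"
      and le: "(\<Sum>j = 0..m. \<epsilon> j) - \<mu>L * upper \<E> - \<mu>U * lower \<E> \<le> (\<Sum>j = 1..m. l j * g j xs)"
      unfolding h_sub by blast
    have "\<not> f x \<prec>\<^sub>L\<^sub>U f xs - \<E>" if x: "x \<in> feasible_set {1..m} g" for x
    proof
      assume "f x \<prec>\<^sub>L\<^sub>U f xs - \<E>"
      then have lt: "lower (f x) < lower (f xs) - upper \<E>" "upper (f x) < upper (f xs) - lower \<E>"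
        by (auto simp: less_LU_def)
      have "\<mu>L * lower (f x) + \<mu>U * upper (f x)
          < \<mu>L * (lower (f xs) - upper \<E>) + \<mu>U * (upper (f xs) - lower \<E>)"
        using lt \<mu> by (rule convex_combination_strict_mono)
      then have "F \<mu>L \<mu>U x < F \<mu>L \<mu>U xs - \<mu>L * upper \<E> - \<mu>U * lower \<E>"
        by (simp add: F_def algebra_simps)
      \<comment> \<open>The zero subgradient bounds the Lagrangian at \<open>x\<close> below by its
        value at \<open>xs\<close> minus the sum of the \<open>\<epsilon> j\<close>. The constraint
        sum at \<open>x\<close> is at most 0, and \<open>le\<close> controls the one at
        \<open>xs\<close>.\<close>
      moreover have "0 \<in> eps_subdifferential (\<Sum>j = 0..m. \<epsilon> j) (\<lambda>x. \<Sum>j = 0..m. h \<mu>L \<mu>U l j x) xs"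
        using sub by (intro eps_subdifferential_sumD) auto
      then have "- (\<Sum>j = 0..m. \<epsilon> j) \<le> (F \<mu>L \<mu>U x + (\<Sum>j = 1..m. l j * g j x))
          - (F \<mu>L \<mu>U xs + (\<Sum>j = 1..m. l j * g j xs))"
        unfolding h_sum eps_subdifferential_def by simp
      moreover have "(\<Sum>j = 1..m. l j * g j x) \<le> 0"
        using l x by (auto simp: feasible_set_def intro!: sum_nonpos mult_nonneg_nonpos)
      ultimately show False
        using le by linarith
    qed
    then show "weakly_LU_solution \<E> f (feasible_set {1..m} g) xs"
      using assms(5) by (auto simp: weakly_LU_solution_def)
  qed
qed

end
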